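(* The following two statements are equivalent. (1) As $p\to\infty$ through the odd primes, $\sup_{j\in\mathbb{F}_p^\times}\Lambda_{S_j}(\vartheta)\to\Lambda_\flat(\vartheta)$ uniformly for $0\le\vartheta\le4$, where $$\Lambda_\flat(\vartheta)=\begin{cases}0,&0\le\vartheta<2,\\ \frac{\vartheta-2}{2},&2\le\vartheta\le3,\\ \frac12,&3<\vartheta\le4.\end{cases}$$ (2) $\sup_{j\in\mathbb{F}_p^\times}\Lambda_{S_j}(2)\to0$ as $p\to\infty$ through the odd primes.
   Context: Statement (1) is the paper's Localized Spherical Restriction/Extension Conjecture. For an odd prime $p$, let $\chi(y)=e^{2\pi i y/p}$ on $\mathbb{F}_p$, $Q_4(x)=x_1^2+\dots+x_4^2$, and for $j\in\mathbb{F}_p^\times$ let $S_j=\{x\in\mathbb{F}_p^4:Q_4(x)=j\}$ with uniform probability measure $d\sigma_j$, so $\|f\|_{L^2(S_j,d\sigma_j)}=\big(\frac1{|S_j|}\sum_{\xi\in S_j}|f(\xi)|^2\big)^{1/2}$. Let $(f\,d\sigma_j)^\vee(x)=\frac1{|S_j|}\sum_{y\in S_j}f(y)\chi(y\cdot x)$, and let $L^2(E)$ use counting measure. For $0\le\vartheta\le4$, $\Lambda_{S_j}(\vartheta)$ is the infimum of all $\lambda\ge0$ such that for every $E\subseteq\mathbb{F}_p^4$ with $1\le|E|\le p^\vartheta$ and every $f:S_j\to\mathbb{C}$, $\|(f\,d\sigma_j)^\vee\|_{L^2(E)}\le p^\lambda\|f\|_{L^2(S_j,d\sigma_j)}$.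 Equivalently (by duality), it is the infimum of $\lambda\ge0$ such that for every such $E$ and every $g:\mathbb{F}_p^4\to\mathbb{C}$ supported on $E$, $\|\widehat g\|_{L^2(S_j,d\sigma_j)}\le p^\lambda\|g\|_{L^2(\mathbb{F}_p^4)}$, where $\widehat g(\xi)=\sum_x g(x)\chi(-x\cdot\xi)$ and $L^2(\mathbb{F}_p^4)$ uses counting measure. *)

theory Defs
  imports "HOL-Analysis.Analysis" "HOL-Number_Theory.Number_Theory"
begin

(* Since p varies, F_p is not a type here: its elements are the representatives 0, ..., p - 1,
   and equations in F_p are congruences modulo p. *)

definition Fp :: "nat \<Rightarrow> int set" where
  "Fp p = {0..<int p}"

definition Fp_units :: "nat \<Rightarrow> int set" where
  "Fp_units p = Fp p - {0}"

definition Fp4 :: "nat \<Rightarrow> (int ^ 4) set" where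
  "Fp4 p = {x. \<forall>i. x $ i \<in> Fp p}"

definition dot :: "int ^ 4 \<Rightarrow> int ^ 4 \<Rightarrow> int" where
  "dot x y = (\<Sum>i\<in>UNIV. x $ i * y $ i)"

definition Q4 :: "int ^ 4 \<Rightarrow> int" where
  "Q4 x = (\<Sum>i\<in>UNIV. (x $ i)\<^sup>2)"

definition sphere4 :: "nat \<Rightarrow> int \<Rightarrow> (int ^ 4) set" where
  "sphere4 p j = {x \<in> Fp4 p. [Q4 x = j] (mod int p)}"

(* p-periodic in y, hence a function on F_p *)
definition chi :: "nat \<Rightarrow> int \<Rightarrow> complex" where
  "chi p y = exp (2 * complex_of_real pi * \<i> * of_int y / of_nat p)"

(* Functions on a set S of points are total functions of which only the values on S are used. *)

definition L2_surface :: "(int ^ 4) set \<Rightarrow> (int ^ 4 \<Rightarrow> complex) \<Rightarrow> real" where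
  "L2_surface S f = sqrt (1 / real (card S) * (\<Sum>\<xi>\<in>S. (cmod (f \<xi>))\<^sup>2))"

definition L2_count :: "(int ^ 4) set \<Rightarrow> (int ^ 4 \<Rightarrow> complex) \<Rightarrow> real" where
  "L2_count E g = sqrt (\<Sum>x\<in>E. (cmod (g x))\<^sup>2)"

definition extension ::
    "nat \<Rightarrow> (int ^ 4) set \<Rightarrow> (int ^ 4 \<Rightarrow> complex) \<Rightarrow> int ^ 4 \<Rightarrow> complex" where
  "extension p S f x = 1 / of_nat (card S) * (\<Sum>y\<in>S. f y * chi p (dot y x))"

definition Lambda :: "nat \<Rightarrow> (int ^ 4) set \<Rightarrow> real \<Rightarrow> real" where
  "Lambda p S \<theta> = Inf {a. 0 \<le> a \<and>
     (\<forall>E f. E \<subseteq> Fp4 p \<and> 1 \<le> card E \<and> real (card E) \<le> real p powr \<theta> \<longrightarrow>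
        L2_count E (extension p S f) \<le> real p powr a * L2_surface S f)}"

definition Lambda_flat :: "real \<Rightarrow> real" where
  "Lambda_flat \<theta> = (if \<theta> < 2 then 0 else if \<theta> \<le> 3 then (\<theta> - 2) / 2 else 1 / 2)"

definition odd_primes_at_top :: "nat filter" where
  "odd_primes_at_top = inf at_top (principal {p. prime p \<and> odd p})"

end

theory Submission
  imports Defs
begin

text \<open>
One implication is immediate: \<open>Lambda_flat 2 = 0\<close>. For the other one, fix an odd prime \<open>p\<close> and a sphere
\<open>S = sphere4 p j\<close>, and put \<open>\<lambda> = Lambda p S 2\<close>. Everything follows from the estimate
\<open>|Lambda p S \<theta> - Lambda_flat \<theta>| \<le> \<lambda> + log p 2\<close> (\<open>Lambda_sphere4_near_flat\<close>), whose right-hand side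
does not involve \<open>\<theta>\<close>: take the supremum over \<open>j\<close> and let \<open>p\<close> tend to infinity.

The upper bounds on \<open>Lambda p S \<theta>\<close> come from three sources. For \<open>\<theta> \<le> 2\<close> it is at most \<open>\<lambda>\<close> by
monotonicity. For \<open>\<theta> \<ge> 2\<close>, a set of at most \<open>p\<^sup>\<theta>\<close> points is cut into about \<open>p\<^sup>\<theta>\<^sup>-\<^sup>2\<close> sets of at most
\<open>p\<^sup>2\<close> points, and squared norms add up (\<open>Lambda_le_split\<close>). For all \<open>\<theta>\<close>, Plancherel bounds the squared
norm on the whole space by \<open>p\<^sup>4 / |S|\<close> times that of the function, which is about \<open>p\<close>
(\<open>Lambda_sphere4_le_half\<close>).

The lower bounds come from one example. Modulo \<open>p\<close> there are \<open>a\<close>, \<open>b\<close> with \<open>a\<^sup>2 + b\<^sup>2 = -1\<close>, so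
\<open>(a, b, 1, 0)\<close> is isotropic, and \<open>S\<close> contains a line in that direction (\<open>sphere4_line\<close>). The extension
of the indicator of the line has constant absolute value \<open>p / |S|\<close> on a hyperplane. Choosing about
\<open>p\<^sup>\<theta>\<close> points there gives \<open>Lambda p S \<theta> \<ge> (\<theta> - 2) / 2 - log p 2\<close> for \<open>2 \<le> \<theta> \<le> 3\<close>. The same example
at \<open>\<theta> = 2\<close> shows \<open>|S| \<ge> p\<^sup>3\<^sup>-\<^sup>2\<^sup>\<lambda>\<close> (\<open>line_test\<close>), which replaces a count of the points of \<open>S\<close> in
the Plancherel step; in the other direction the crude bound \<open>|S| \<le> 2 p\<^sup>3\<close> is enough.
\<close>

section \<open>Characters and the Plancherel identity\<close>

lemma chi_add: "chi p (a + b) = chi p a * chi p b"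
  by (simp add: chi_def exp_add [symmetric] add_divide_distrib algebra_simps)

lemma chi_eq_1_iff:
  assumes "p > 0"
  shows "chi p a = 1 \<longleftrightarrow> int p dvd a"
proof -
  have "chi p a = exp (\<i> * complex_of_real (2 * pi * (a / p)))"
    by (simp add: chi_def algebra_simps)
  also have "\<dots> = 1 \<longleftrightarrow> (\<exists>n::int. 2 * pi * (a / p) = 2 * real_of_int n * pi)"
    by (simp add: exp_eq_1)
  also have "\<dots> \<longleftrightarrow> (\<exists>n::int. real_of_int a = real_of_int (int p * n))"
    using assms by (simp add: field_simps)
  also have "\<dots> \<longleftrightarrow> int p dvd a"
    unfolding of_int_eq_iff dvd_def by (rule refl)
  finally show ?thesis .
qed

lemma chi_cong:
  assumes "p > 0" "[a = b] (mod int p)"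
  shows "chi p a = chi p b"
proof -
  have "chi p (a - b) = 1"
    using assms by (simp add: chi_eq_1_iff cong_iff_dvd_diff)
  with chi_add [of p "a - b" b] show ?thesis by simp
qed

lemma norm_chi [simp]: "cmod (chi p a) = 1"
proof -
  have "chi p a = exp (\<i> * complex_of_real (2 * pi * (a / p)))"
    by (simp add: chi_def algebra_simps)
  then show ?thesis by (metis norm_exp_i_times)
qed

lemma cnj_chi: "cnj (chi p a) = chi p (- a)"
  by (simp add: chi_def exp_cnj)

lemma finite_Fp4: "finite (Fp4 p)"
  and card_Fp4: "card (Fp4 p) = p ^ 4"
proof -
  have eq: "Fp4 p = vec_lambda ` (PiE UNIV (\<lambda>_. Fp p))"
  proof (intro subset_antisym subsetI)
    fix x assume "x \<in> Fp4 p"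
    then have "vec_lambda (vec_nth x) \<in> vec_lambda ` (PiE UNIV (\<lambda>_. Fp p))"
      by (intro imageI) (auto simp: Fp4_def PiE_def)
    then show "x \<in> vec_lambda ` (PiE UNIV (\<lambda>_. Fp p))" by simp
  qed (auto simp: Fp4_def PiE_def)
  have fin: "finite (PiE (UNIV :: 4 set) (\<lambda>_. Fp p))"
    by (intro finite_PiE) (auto simp: Fp_def)
  have inj: "inj_on (vec_lambda :: (4 \<Rightarrow> int) \<Rightarrow> _) (PiE UNIV (\<lambda>_. Fp p))"
    by (intro inj_onI) (metis vec_lambda_inverse UNIV_I)
  show "finite (Fp4 p)" unfolding eq by (intro finite_imageI fin)
  show "card (Fp4 p) = p ^ 4"
    unfolding eq card_image [OF inj] by (simp add: card_PiE Fp_def)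
qed

text \<open>Lines are built from integer vectors by affine formulas; this map brings their points back to the
chosen representatives of the residue classes.\<close>

definition reduce :: "nat \<Rightarrow> int ^ 4 \<Rightarrow> int ^ 4" where
  "reduce p x = (\<chi> i. x $ i mod int p)"

lemma reduce_in_Fp4: "p > 0 \<Longrightarrow> reduce p x \<in> Fp4 p"
  by (simp add: reduce_def Fp4_def Fp_def)

lemma chi_dot_reduce:
  assumes "p > 0"
  shows "chi p (dot w (reduce p x)) = chi p (dot w x)"
    and "chi p (dot (reduce p x) w) = chi p (dot x w)"
  unfolding dot_def reduce_def
  by (auto intro!: chi_cong [OF assms] cong_sum simp: cong_def mod_mult_left_eq mod_mult_right_eq)

lemma Fp4_eqI:
  assumes "x \<in> Fp4 p" "y \<in> Fp4 p" "\<And>i. [x $ i = y $ i] (mod int p)"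
  shows "x = y"
  using assms by (intro vec_eq_iff [THEN iffD2]) (auto simp: Fp4_def Fp_def cong_def)

text \<open>Translating the summation variable by the \<open>i\<close>-th unit vector permutes \<open>F\<^sub>p\<^sup>4\<close> and multiplies
the sum by \<open>chi p (w $ i) \<noteq> 1\<close>, so the sum vanishes.\<close>

lemma character_sum_eq_0:
  assumes p: "p > 0" and w: "\<not> int p dvd w $ i"
  shows "(\<Sum>x\<in>Fp4 p. chi p (dot w x)) = 0"
proof -
  define T where "T = (\<lambda>x. reduce p (x + axis i 1))"
  have T_in: "T x \<in> Fp4 p" for x
    using p by (simp add: T_def reduce_in_Fp4)
  have "inj_on T (Fp4 p)"
  proof (intro inj_onI Fp4_eqI [of _ p])
    fix x y k assume "T x = T y"
    then have "T x $ k = T y $ k" by simp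
    then have "[x $ k + axis i 1 $ k = y $ k + axis i 1 $ k] (mod int p)"
      by (simp add: T_def reduce_def cong_def)
    then show "[x $ k = y $ k] (mod int p)"
      by (simp add: cong_iff_dvd_diff)
  qed
  then have "bij_betw T (Fp4 p) (Fp4 p)"
    using T_in by (simp add: bij_betw_def endo_inj_surj finite_Fp4 image_subset_iff)
  then have "(\<Sum>x\<in>Fp4 p. chi p (dot w x)) = (\<Sum>x\<in>Fp4 p. chi p (dot w (T x)))"
    by (rule sum.reindex_bij_betw [symmetric])
  also have "\<dots> = (\<Sum>x\<in>Fp4 p. chi p (w $ i) * chi p (dot w x))"
  proof (intro sum.cong refl)
    fix x
    have "dot w (x + axis i 1) = w $ i + dot w x"
    proof -
      have "w $ k * (x $ k + axis i 1 $ k) = (if k = i then w $ i else 0) + w $ k * x $ k" for k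
        by (simp add: axis_def distrib_left)
      then show ?thesis by (simp add: dot_def sum.distrib)
    qed
    then show "chi p (dot w (T x)) = chi p (w $ i) * chi p (dot w x)"
      using p by (simp add: T_def chi_dot_reduce chi_add [symmetric])
  qed
  finally have "(1 - chi p (w $ i)) * (\<Sum>x\<in>Fp4 p. chi p (dot w x)) = 0"
    by (simp add: sum_distrib_left [symmetric] left_diff_distrib)
  with w p show ?thesis by (simp add: chi_eq_1_iff)
qed

lemma character_orthogonality:
  assumes "p > 0" "y \<in> Fp4 p" "z \<in> Fp4 p"
  shows "(\<Sum>x\<in>Fp4 p. chi p (dot y x) * cnj (chi p (dot z x))) = (if y = z then of_nat (p ^ 4) else 0)"
proof -
  have "chi p (dot y x) * cnj (chi p (dot z x)) = chi p (dot (y - z) x)" for x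
    by (simp add: cnj_chi chi_add [symmetric] dot_def left_diff_distrib sum_subtractf)
  moreover have "(\<Sum>x\<in>Fp4 p. chi p (dot (y - z) x)) = 0" if neq: "y \<noteq> z"
  proof -
    obtain i where "\<not> [y $ i = z $ i] (mod int p)"
      using Fp4_eqI [OF assms(2,3)] neq by blast
    then show ?thesis
      using assms(1) by (intro character_sum_eq_0 [of p _ i]) (auto simp: cong_iff_dvd_diff)
  qed
  moreover have "chi p (dot 0 x) = 1" for x
    using assms(1) by (simp add: dot_def chi_eq_1_iff)
  ultimately show ?thesis by (simp add: card_Fp4)
qed

text \<open>Expand the square and exchange the sums: by orthogonality only the diagonal pairs survive.\<close>

lemma plancherel:
  assumes p: "p > 0" and S: "S \<subseteq> Fp4 p"
  shows "(\<Sum>x\<in>Fp4 p. (cmod (\<Sum>y\<in>S. g y * chi p (dot y x)))\<^sup>2) = p ^ 4 * (\<Sum>y\<in>S. (cmod (g y))\<^sup>2)"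
proof -
  have finS: "finite S" using S finite_Fp4 finite_subset by blast
  have "complex_of_real (\<Sum>x\<in>Fp4 p. (cmod (\<Sum>y\<in>S. g y * chi p (dot y x)))\<^sup>2) =
        (\<Sum>x\<in>Fp4 p. \<Sum>y\<in>S. \<Sum>z\<in>S. (g y * cnj (g z)) * (chi p (dot y x) * cnj (chi p (dot z x))))"
    by (simp only: of_real_sum complex_norm_square cnj_sum sum_product complex_cnj_mult mult.assoc mult.left_commute)
  also have "\<dots> = (\<Sum>y\<in>S. \<Sum>z\<in>S. \<Sum>x\<in>Fp4 p. (g y * cnj (g z)) * (chi p (dot y x) * cnj (chi p (dot z x))))"
    by (subst sum.swap, rule sum.cong [OF refl], rule sum.swap)
  also have "\<dots> = (\<Sum>y\<in>S. \<Sum>z\<in>S. (g y * cnj (g z)) * (if y = z then of_nat (p ^ 4) else 0))"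
    using S p by (intro sum.cong refl) (simp only: sum_distrib_left [symmetric] character_orthogonality subsetD)
  also have "\<dots> = (\<Sum>y\<in>S. (g y * cnj (g y)) * of_nat (p ^ 4))"
    using finS by (intro sum.cong refl) (simp add: if_distrib cong: if_cong)
  also have "\<dots> = complex_of_real (p ^ 4 * (\<Sum>y\<in>S. (cmod (g y))\<^sup>2))"
    by (simp add: complex_norm_square [symmetric] sum_distrib_left mult.commute)
  finally show ?thesis by (simp only: of_real_eq_iff of_nat_power)
qed

section \<open>Lines in spheres and the size of spheres\<close>

text \<open>There are \<open>(p + 1) / 2\<close> squares modulo \<open>p\<close>, hence as many values \<open>- 1 - b\<^sup>2\<close>; together these are
\<open>p + 1 > p\<close> values, so the two sets meet. The interval \<open>H\<close> below meets each pair \<open>\<plusminus> x\<close> of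
residues once, which makes squaring injective on it.\<close>

lemma minus_one_sum_of_two_squares:
  assumes p: "prime p" "odd p"
  obtains a b :: int where "[a\<^sup>2 + b\<^sup>2 = -1] (mod int p)"
proof -
  define H where "H = {0..(int p - 1) div 2}"
  have p_gt: "int p > 2" using p prime_gt_1_nat [of p] by (cases "p = 2") auto
  have card_H: "2 * card H = p + 1"
    using p(2) p_gt by (auto simp: H_def elim!: oddE)
  have inj: "x = y" if "x \<in> H" "y \<in> H" "[x\<^sup>2 = y\<^sup>2] (mod int p)" for x y
  proof -
    have "int p dvd (x - y) * (x + y)"
      using that(3) by (simp add: cong_iff_dvd_diff power2_eq_square algebra_simps)
    then have "int p dvd x - y \<or> int p dvd x + y"
      using p(1) by (simp add: prime_dvd_mult_iff)
    moreover have "\<bar>x - y\<bar> < int p" "0 \<le> x + y" "x + y < int p"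
      using that(1,2) p_gt by (auto simp: H_def)
    ultimately have "x - y = 0 \<or> x + y = 0"
      using zdvd_not_zless zdvd_imp_le by (smt (verit) dvd_minus_iff)
    then show "x = y" using that(1,2) by (auto simp: H_def)
  qed
  define A where "A = (\<lambda>x. x\<^sup>2 mod int p) ` H"
  define B where "B = (\<lambda>x. (- 1 - x\<^sup>2) mod int p) ` H"
  have "inj_on (\<lambda>x. x\<^sup>2 mod int p) H"
    by (intro inj_onI inj) (auto simp: cong_def)
  then have card_A: "card A = card H" unfolding A_def by (rule card_image)
  have "inj_on (\<lambda>x. (- 1 - x\<^sup>2) mod int p) H"
  proof (intro inj_onI inj)
    fix x y assume "(- 1 - x\<^sup>2) mod int p = (- 1 - y\<^sup>2) mod int p"
    then have "int p dvd - (x\<^sup>2 - y\<^sup>2)"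
      by (simp add: mod_eq_dvd_iff)
    then show "[x\<^sup>2 = y\<^sup>2] (mod int p)" by (simp only: dvd_minus_iff cong_iff_dvd_diff)
  qed
  then have card_B: "card B = card H" unfolding B_def by (rule card_image)
  have fin: "finite A" "finite B" by (auto simp: A_def B_def H_def)
  have "A \<union> B \<subseteq> {0..<int p}" using p_gt by (auto simp: A_def B_def)
  then have "card (A \<union> B) \<le> p" using card_mono [of "{0..<int p}" "A \<union> B"] by simp
  then have "A \<inter> B \<noteq> {}"
    using card_Un_disjoint [OF fin] card_A card_B card_H by auto
  then obtain a b where "a\<^sup>2 mod int p = (- 1 - b\<^sup>2) mod int p"
    by (auto simp: A_def B_def)
  then have "[a\<^sup>2 + b\<^sup>2 = -1] (mod int p)"
    by (simp add: cong_iff_dvd_diff mod_eq_dvd_iff algebra_simps)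
  then show ?thesis by (rule that)
qed

text \<open>The first three coordinates determine the last one up to sign, and two distinct residues
\<open>x\<close> and \<open>- x\<close> lie in different halves of \<open>{0..<p}\<close>. The half is recorded as a truth value.\<close>

lemma card_sphere4_le:
  assumes p: "prime p"
  shows "card (sphere4 p j) \<le> 2 * p ^ 3"
proof -
  define h where "h = (\<lambda>x :: int ^ 4. (x $ 1, x $ 2, x $ 3, 2 * x $ 4 \<le> int p))"
  have "inj_on h (sphere4 p j)"
  proof (rule inj_onI)
    fix x y assume x: "x \<in> sphere4 p j" and y: "y \<in> sphere4 p j" and h: "h x = h y"
    have eq: "x $ 1 = y $ 1" "x $ 2 = y $ 2" "x $ 3 = y $ 3" "(2 * x $ 4 \<le> int p) = (2 * y $ 4 \<le> int p)"
      using h by (auto simp: h_def)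
    have rng: "0 \<le> x $ 4" "x $ 4 < int p" "0 \<le> y $ 4" "y $ 4 < int p"
      using x y by (auto simp: sphere4_def Fp4_def Fp_def)
    have "[Q4 x = Q4 y] (mod int p)"
      using x y by (auto simp: sphere4_def cong_def)
    then have "int p dvd (x $ 4 - y $ 4) * (x $ 4 + y $ 4)"
      by (simp add: Q4_def sum_4 eq cong_iff_dvd_diff power2_eq_square algebra_simps)
    then consider "int p dvd x $ 4 - y $ 4" | "int p dvd x $ 4 + y $ 4"
      using p by (auto simp: prime_dvd_mult_iff)
    then have "x $ 4 = y $ 4"
    proof cases
      case 1
      then have "x $ 4 mod int p = y $ 4 mod int p" by (simp add: mod_eq_dvd_iff)
      then show ?thesis using rng by simp
    next
      case 2
      then obtain k where k: "x $ 4 + y $ 4 = int p * k" by (auto elim: dvdE)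
      have "0 \<le> int p * k" "int p * k < int p * 2" using rng k by linarith+
      moreover have "0 < int p" using rng by linarith
      ultimately have "0 \<le> k" "k < 2" by (simp_all add: zero_le_mult_iff)
      then have "k = 0 \<or> k = 1" by linarith
      with k eq(4) rng show ?thesis by auto
    qed
    with eq show "x = y" by (simp add: vec_eq_iff forall_4)
  qed
  moreover have "h ` sphere4 p j \<subseteq> Fp p \<times> Fp p \<times> Fp p \<times> UNIV"
    by (auto simp: h_def sphere4_def Fp4_def)
  ultimately have "card (sphere4 p j) \<le> card (Fp p \<times> Fp p \<times> Fp p \<times> (UNIV :: bool set))"
    by (intro card_inj_on_le) (auto simp: Fp_def)
  also have "\<dots> = 2 * p ^ 3"
    by (simp add: card_cartesian_product Fp_def power3_eq_cube)
  finally show ?thesis .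
qed

definition vec4 :: "int \<Rightarrow> int \<Rightarrow> int \<Rightarrow> int \<Rightarrow> int ^ 4" where
  "vec4 a b c d = (\<chi> i. if i = 1 then a else if i = 2 then b else if i = 3 then c else d)"

lemma vec4_nth [simp]:
  "vec4 a b c d $ 1 = a" "vec4 a b c d $ 2 = b" "vec4 a b c d $ 3 = c" "vec4 a b c d $ 4 = d"
  by (simp_all add: vec4_def)

lemma Q4_reduce: "[Q4 (reduce p x) = Q4 x] (mod int p)"
  unfolding Q4_def reduce_def by (intro cong_sum) (auto simp: cong_def power_mod)

text \<open>This is where it matters that the sum of four squares splits modulo \<open>p\<close> into two
hyperbolic planes. With \<open>a\<^sup>2 + b\<^sup>2 = -1\<close>, the vector \<open>d = (a, b, 1, 0)\<close> is isotropic, and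
\<open>v = (- b m, a m, 0, n)\<close> is orthogonal to it with \<open>Q\<^sub>4 v = n\<^sup>2 - m\<^sup>2\<close>, so \<open>Q\<^sub>4\<close> is constant
along \<open>v + t d\<close>. The values \<open>n = (j + 1) / 2\<close> and \<open>m = (j - 1) / 2\<close> make the constant \<open>j\<close>.
The third coordinate of \<open>v + t d\<close> is \<open>t\<close>, so the points are distinct.\<close>

lemma sphere4_line:
  assumes p: "prime p" "odd p"
  obtains d v where "d $ 3 = 1" "v $ 3 = 0" "\<And>t. [Q4 (v + t *s d) = j] (mod int p)"
proof -
  obtain a b where ab: "[a\<^sup>2 + b\<^sup>2 = -1] (mod int p)"
    using minus_one_sum_of_two_squares [OF p] .
  \<comment> \<open>the inverse of 2 modulo \<open>p\<close>\<close>
  define h where "h = (int p + 1) div 2"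
  have h: "2 * h = int p + 1" using p(2) by (auto simp: h_def elim!: oddE)
  define m where "m = h * (j - 1)"
  define n where "n = h * (j + 1)"
  define d where "d = vec4 a b 1 0"
  define v where "v = vec4 (- b * m) (a * m) 0 n"
  have "[Q4 (v + t *s d) = j] (mod int p)" for t
  proof -
    have nm: "n\<^sup>2 - m\<^sup>2 = (2 * h)\<^sup>2 * j"
      by (simp add: n_def m_def power2_eq_square algebra_simps)
    have "Q4 (v + t *s d) = (a\<^sup>2 + b\<^sup>2 + 1) * (m\<^sup>2 + t\<^sup>2) + (n\<^sup>2 - m\<^sup>2)"
      by (simp add: Q4_def sum_4 v_def d_def power2_eq_square algebra_simps)
    also have "\<dots> - j = (a\<^sup>2 + b\<^sup>2 - (-1)) * (m\<^sup>2 + t\<^sup>2) + int p * (int p + 2) * j"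
      unfolding nm h by (simp add: power2_eq_square algebra_simps)
    finally show ?thesis
      using ab by (simp add: cong_iff_dvd_diff)
  qed
  then show ?thesis by (intro that [of d v]) (simp_all add: d_def v_def)
qed

lemma sphere4_subset: "sphere4 p j \<subseteq> Fp4 p"
  by (auto simp: sphere4_def)

lemma card_sphere4_pos:
  assumes p: "prime p" "odd p"
  shows "card (sphere4 p j) > 0"
proof -
  obtain d v where "[Q4 (v + 0 *s d) = j] (mod int p)"
    using sphere4_line [OF p] by metis
  then have "reduce p (v + 0 *s d) \<in> sphere4 p j"
    using prime_gt_0_nat [OF p(1)] Q4_reduce [of p "v + 0 *s d"]
    by (auto simp: sphere4_def reduce_in_Fp4 intro: cong_trans)
  moreover have "finite (sphere4 p j)" by (rule finite_subset [OF sphere4_subset finite_Fp4])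
  ultimately show ?thesis by (auto simp: card_gt_0_iff)
qed

section \<open>The extension exponent of a general set\<close>

text \<open>The squared form of the inequality in the definition of \<open>Lambda\<close>. Squared \<open>L\<^sup>2\<close> norms are additive
over disjoint pieces of \<open>E\<close>, which is what the splitting argument uses.\<close>

definition extension_bound :: "nat \<Rightarrow> (int ^ 4) set \<Rightarrow> real \<Rightarrow> real \<Rightarrow> bool" where
  "extension_bound p S \<theta> a \<longleftrightarrow>
     (\<forall>E f. E \<subseteq> Fp4 p \<and> 1 \<le> card E \<and> real (card E) \<le> real p powr \<theta> \<longrightarrow>
        (\<Sum>x\<in>E. (cmod (extension p S f x))\<^sup>2)
          \<le> real p powr (2 * a) * ((\<Sum>\<xi>\<in>S. (cmod (f \<xi>))\<^sup>2) / card S))"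

lemma Lambda_eq_Inf:
  "Lambda p S \<theta> = Inf {a. 0 \<le> a \<and> extension_bound p S \<theta> a}"
proof -
  have "sqrt A \<le> real p powr a * sqrt (1 / real (card S) * B) \<longleftrightarrow> A \<le> real p powr (2 * a) * (B / card S)"
    for A B a
  proof -
    have "real p powr a = sqrt (real p powr (2 * a))"
      by (simp add: powr_half_sqrt [symmetric] powr_powr)
    then have "real p powr a * sqrt (1 / real (card S) * B) = sqrt (real p powr (2 * a) * (B / card S))"
      by (simp add: real_sqrt_mult real_sqrt_divide)
    then show ?thesis by simp
  qed
  then show ?thesis
    by (simp only: Lambda_def extension_bound_def L2_count_def L2_surface_def)
qed

lemma extension_boundD:
  assumes "extension_bound p S \<theta> a" "E \<subseteq> Fp4 p" "real (card E) \<le> real p powr \<theta>"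
  shows "(\<Sum>x\<in>E. (cmod (extension p S f x))\<^sup>2)
          \<le> real p powr (2 * a) * ((\<Sum>\<xi>\<in>S. (cmod (f \<xi>))\<^sup>2) / card S)"
proof (cases "E = {}")
  case True
  then show ?thesis by (simp add: sum_nonneg)
next
  case False
  then have "1 \<le> card E"
    using assms(2) finite_Fp4 finite_subset by (metis One_nat_def Suc_leI card_gt_0_iff)
  with assms show ?thesis unfolding extension_bound_def by blast
qed

lemma plancherel_extension:
  assumes "p > 0" "S \<subseteq> Fp4 p"
  shows "(\<Sum>x\<in>Fp4 p. (cmod (extension p S f x))\<^sup>2)
           = (real p ^ 4 / card S) * ((\<Sum>\<xi>\<in>S. (cmod (f \<xi>))\<^sup>2) / card S)"
proof -
  have "(cmod (extension p S f x))\<^sup>2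
      = (cmod (\<Sum>y\<in>S. f y * chi p (dot y x)))\<^sup>2 / (real (card S))\<^sup>2" for x
    by (simp add: extension_def norm_divide power_divide)
  then show ?thesis
    by (simp add: plancherel [OF assms] sum_divide_distrib [symmetric])
      (simp add: power2_eq_square)
qed

text \<open>Enlarging \<open>E\<close> to the whole space turns the inequality into the Plancherel identity.\<close>

lemma extension_bound_plancherel:
  assumes "p > 0" "S \<subseteq> Fp4 p" "real p ^ 4 / card S \<le> real p powr (2 * a)"
  shows "extension_bound p S \<theta> a"
  unfolding extension_bound_def
proof (intro allI impI, elim conjE)
  fix E f assume "E \<subseteq> Fp4 p"
  then have "(\<Sum>x\<in>E. (cmod (extension p S f x))\<^sup>2) \<le> (\<Sum>x\<in>Fp4 p. (cmod (extension p S f x))\<^sup>2)"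
    by (intro sum_mono2 finite_Fp4) auto
  also have "\<dots> \<le> real p powr (2 * a) * ((\<Sum>\<xi>\<in>S. (cmod (f \<xi>))\<^sup>2) / card S)"
    unfolding plancherel_extension [OF assms(1,2)]
    by (intro mult_right_mono assms(3)) (simp add: sum_nonneg)
  finally show "(\<Sum>x\<in>E. (cmod (extension p S f x))\<^sup>2) \<le> \<dots>" .
qed

lemma Lambda_le:
  assumes "0 \<le> a" "extension_bound p S \<theta> a"
  shows "Lambda p S \<theta> \<le> a"
  unfolding Lambda_eq_Inf using assms by (intro cInf_lower) (auto intro!: bdd_belowI)

text \<open>The infimum in the definition of \<open>Lambda\<close> is attained: the admissible exponents form a closed set,
which contains \<open>2\<close> by Plancherel. Attainment spares an extra \<open>\<epsilon>\<close> in all later estimates.\<close>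

lemma
  assumes "p > 0" "S \<subseteq> Fp4 p"
  shows Lambda_nonneg: "0 \<le> Lambda p S \<theta>"
    and extension_bound_Lambda: "extension_bound p S \<theta> (Lambda p S \<theta>)"
proof -
  let ?A = "{a. 0 \<le> a \<and> extension_bound p S \<theta> a}"
  have "real p ^ 4 / card S \<le> real p powr (2 * 2)"
    using assms(1) by (cases "card S = 0") (auto simp: divide_le_eq_1 field_simps powr_numeral)
  then have "2 \<in> ?A" using extension_bound_plancherel [OF assms] by simp
  then have "?A \<noteq> {}" by blast
  moreover have "bdd_below ?A" by (intro bdd_belowI [of _ 0]) auto
  moreover have "closed ?A"
    unfolding extension_bound_def using assms(1)
    by (intro closed_Collect_conj closed_Collect_all closed_Collect_imp closed_Collect_le
        open_Collect_const continuous_intros) auto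
  ultimately have "Inf ?A \<in> ?A" by (rule closed_contains_Inf)
  then show "0 \<le> Lambda p S \<theta>" "extension_bound p S \<theta> (Lambda p S \<theta>)"
    by (auto simp: Lambda_eq_Inf)
qed

lemma Lambda_mono:
  assumes "p > 0" "S \<subseteq> Fp4 p" "\<theta> \<le> \<theta>'"
  shows "Lambda p S \<theta> \<le> Lambda p S \<theta>'"
proof (intro Lambda_le Lambda_nonneg assms)
  have "real p powr \<theta> \<le> real p powr \<theta>'"
    using assms by (intro powr_mono) auto
  then show "extension_bound p S \<theta> (Lambda p S \<theta>')"
    using extension_bound_Lambda [OF assms(1,2), of \<theta>'] unfolding extension_bound_def
    by (meson order_trans)
qed

section \<open>Splitting a set into pieces of bounded size\<close>

text \<open>A set of \<open>n\<close> points is a union of at most \<open>n / k + 1\<close> sets of at most \<open>k\<close> points: remove \<open>k\<close> points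
at a time.\<close>

lemma sum_le_by_pieces:
  fixes w :: "'a \<Rightarrow> real"
  assumes "finite E" "0 < k" and B: "\<And>T. T \<subseteq> E \<Longrightarrow> card T \<le> k \<Longrightarrow> sum w T \<le> B"
  shows "sum w E \<le> (card E / k + 1) * B"
  using assms(1) B
proof (induction "card E" arbitrary: E rule: less_induct)
  case less
  have "0 \<le> B" using less.prems(2) [of "{}"] by simp
  show ?case
  proof (cases "card E \<le> k")
    case True
    then have "sum w E \<le> 1 * B" using less.prems(2) [of E] by simp
    also have "\<dots> \<le> (card E / k + 1) * B" using \<open>0 \<le> B\<close> by (intro mult_right_mono) auto
    finally show ?thesis .
  next
    case False
    then obtain T where T: "T \<subseteq> E" "card T = k" "finite T"
      using obtain_subset_with_card_n [of k E] by auto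
    have card_diff: "card (E - T) = card E - k" using T by (simp add: card_Diff_subset)
    have "sum w (E - T) \<le> (card (E - T) / k + 1) * B"
      using False assms(2) less.prems card_diff by (intro less.hyps) auto
    moreover have "sum w T \<le> B" using less.prems(2) T by simp
    moreover have "sum w E = sum w (E - T) + sum w T"
      using less.prems(1) T(1) by (rule sum.subset_diff [rotated])
    moreover have "card (E - T) / k = card E / k - 1"
      using False assms(2) card_diff by (simp add: of_nat_diff diff_divide_distrib)
    ultimately show ?thesis by (simp add: algebra_simps)
  qed
qed

text \<open>A set of at most \<open>p\<^sup>\<theta>\<close> points consists of at most \<open>p\<^sup>\<theta>\<^sup>-\<^sup>2 + 1 \<le> 2 p\<^sup>\<theta>\<^sup>-\<^sup>2\<close> pieces of at most
\<open>p\<^sup>2\<close> points, to each of which the exponent at \<open>2\<close> applies. The factor \<open>2\<close> in the squared norm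
accounts for \<open>log p 2 / 2\<close>.\<close>

lemma Lambda_le_split:
  assumes p: "p > 1" and S: "S \<subseteq> Fp4 p" and "2 \<le> \<theta>"
  shows "Lambda p S \<theta> \<le> Lambda p S 2 + (\<theta> - 2) / 2 + log p 2 / 2"
proof (rule Lambda_le)
  let ?m = "Lambda p S 2"
  have p0: "p > 0" using p by simp
  show "0 \<le> ?m + (\<theta> - 2) / 2 + log p 2 / 2"
    using Lambda_nonneg [OF p0 S, of 2] assms by simp
  show "extension_bound p S \<theta> (?m + (\<theta> - 2) / 2 + log p 2 / 2)"
    unfolding extension_bound_def
  proof (intro allI impI, elim conjE)
    fix E f assume E: "E \<subseteq> Fp4 p" "real (card E) \<le> real p powr \<theta>"
    define Y where "Y = (\<Sum>\<xi>\<in>S. (cmod (f \<xi>))\<^sup>2) / card S"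
    have "0 \<le> Y" by (simp add: Y_def sum_nonneg)
    have p2: "real p powr 2 = p\<^sup>2" using p by (simp add: powr_numeral)
    have "(\<Sum>x\<in>E. (cmod (extension p S f x))\<^sup>2) \<le> (card E / (p\<^sup>2) + 1) * (real p powr (2 * ?m) * Y)"
    proof (rule sum_le_by_pieces)
      show "finite E" using E(1) finite_Fp4 finite_subset by blast
      fix T assume "T \<subseteq> E" "card T \<le> p\<^sup>2"
      then show "(\<Sum>x\<in>T. (cmod (extension p S f x))\<^sup>2) \<le> real p powr (2 * ?m) * Y"
        unfolding Y_def using E(1) p2
        by (intro extension_boundD [OF extension_bound_Lambda [OF p0 S]]) (auto simp flip: of_nat_power)
    qed (use p in simp)
    also have "\<dots> \<le> (2 * real p powr (\<theta> - 2)) * (real p powr (2 * ?m) * Y)"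
    proof (rule mult_right_mono)
      have "card E / (p\<^sup>2) \<le> real p powr (\<theta> - 2)"
        using E(2) p by (simp add: powr_diff p2 divide_right_mono)
      moreover have "1 \<le> real p powr (\<theta> - 2)"
        using p assms(3) by (simp add: ge_one_powr_ge_zero)
      ultimately show "card E / (p\<^sup>2) + 1 \<le> 2 * real p powr (\<theta> - 2)" by linarith
    qed (use \<open>0 \<le> Y\<close> in simp)
    also have "\<dots> = real p powr (2 * (?m + (\<theta> - 2) / 2 + log p 2 / 2)) * Y"
    proof -
      have "2 * (?m + (\<theta> - 2) / 2 + log p 2 / 2) = (\<theta> - 2) + log p 2 + 2 * ?m"
        by (simp add: field_simps)
      then show ?thesis using p by (simp only: powr_add) simp
    qed
    finally show "(\<Sum>x\<in>E. (cmod (extension p S f x))\<^sup>2)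
        \<le> real p powr (2 * (?m + (\<theta> - 2) / 2 + log p 2 / 2)) * ((\<Sum>\<xi>\<in>S. (cmod (f \<xi>))\<^sup>2) / card S)"
      by (simp only: Y_def)
  qed
qed

section \<open>The indicator of a line as test function\<close>

text \<open>Since \<open>d $ 3 = 1\<close>, the other three coordinates of a point of the hyperplane are free.\<close>

lemma card_hyperplane_ge:
  assumes "p > 0" "d $ 3 = 1"
  shows "p ^ 3 \<le> card {x \<in> Fp4 p. int p dvd dot d x}"
proof -
  define h where "h = (\<lambda>(x, y, z). reduce p (vec4 x y (- (d $ 1 * x + d $ 2 * y + d $ 4 * z)) z))"
  have "inj_on h (Fp p \<times> Fp p \<times> Fp p)"
  proof (rule inj_onI)
    fix s t assume st: "s \<in> Fp p \<times> Fp p \<times> Fp p" "t \<in> Fp p \<times> Fp p \<times> Fp p" and "h s = h t"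
    then have "h s $ 1 = h t $ 1" "h s $ 2 = h t $ 2" "h s $ 4 = h t $ 4" by simp_all
    with st show "s = t"
      by (cases s; cases t) (simp add: h_def reduce_def Fp_def)
  qed
  moreover have "h ` (Fp p \<times> Fp p \<times> Fp p) \<subseteq> {x \<in> Fp4 p. int p dvd dot d x}"
  proof clarify
    fix x y z
    let ?u = "vec4 x y (- (d $ 1 * x + d $ 2 * y + d $ 4 * z)) z"
    have "chi p (dot d (reduce p ?u)) = chi p (dot d ?u)"
      using assms by (intro chi_dot_reduce)
    also have "dot d ?u = 0" by (simp add: dot_def sum_4 assms)
    finally show "h (x, y, z) \<in> Fp4 p \<and> int p dvd dot d (h (x, y, z))"
      using assms by (simp add: h_def reduce_in_Fp4 chi_eq_1_iff [symmetric])
        (simp add: chi_eq_1_iff)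
  qed
  ultimately have "card (Fp p \<times> Fp p \<times> Fp p) \<le> card {x \<in> Fp4 p. int p dvd dot d x}"
    by (intro card_inj_on_le) (auto intro: finite_subset [OF _ finite_Fp4 [of p]])
  then show ?thesis by (simp add: card_cartesian_product Fp_def power3_eq_cube)
qed

text \<open>The test function is the indicator of a line \<open>v + t d\<close> in the sphere. On the hyperplane orthogonal to
\<open>d\<close> all characters \<open>x \<mapsto> chi p (dot y x)\<close> with \<open>y\<close> on the line coincide, so the extension has
absolute value \<open>p / |S|\<close> at each of its \<open>p\<^sup>3\<close> points, while the squared norm of the indicator is
\<open>p / |S|\<close>. Any \<open>n\<close> points of the hyperplane give the inequality.

For \<open>n\<close> near \<open>p\<^sup>\<theta>\<close> this is a lower bound on \<open>Lambda\<close>; for \<open>\<theta> = 2\<close> and \<open>n = p\<^sup>2\<close> it is also a lower bound on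
the size of the sphere in terms of \<open>Lambda p (sphere4 p j) 2\<close>.\<close>

lemma line_test:
  assumes p: "prime p" "odd p" and n: "n \<le> p ^ 3" "real n \<le> real p powr \<theta>"
  shows "real n * p / card (sphere4 p j) \<le> real p powr (2 * Lambda p (sphere4 p j) \<theta>)"
proof -
  let ?S = "sphere4 p j"
  have p0: "p > 0" using p(1) prime_gt_0_nat by blast
  obtain d v where d: "d $ 3 = 1" "v $ 3 = 0" and line: "\<And>t. [Q4 (v + t *s d) = j] (mod int p)"
    using sphere4_line [OF p] by blast
  define pt where "pt = (\<lambda>t. reduce p (v + t *s d))"
  define L where "L = pt ` Fp p"
  define f :: "int ^ 4 \<Rightarrow> complex" where "f = (\<lambda>y. if y \<in> L then 1 else 0)"
  have finS: "finite ?S" using sphere4_subset finite_Fp4 finite_subset by blast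
  have inj: "inj_on pt (Fp p)"
  proof (rule inj_onI)
    fix s t assume st: "s \<in> Fp p" "t \<in> Fp p" "pt s = pt t"
    from st(3) have "pt s $ 3 = pt t $ 3" by simp
    with st(1,2) show "s = t" by (simp add: pt_def reduce_def d Fp_def)
  qed
  have card_L: "card L = p" using inj by (simp add: L_def card_image Fp_def)
  have "pt t \<in> ?S" for t
    using line [of t] Q4_reduce [of p "v + t *s d"] p0
    by (auto simp: pt_def sphere4_def reduce_in_Fp4 intro: cong_trans)
  then have L_sub: "L \<subseteq> ?S" by (auto simp: L_def)
  have "card ?S > 0" by (rule card_sphere4_pos [OF p])
  obtain E where E: "E \<subseteq> {x \<in> Fp4 p. int p dvd dot d x}" "card E = n"
    by (rule obtain_subset_with_card_n [OF order_trans [OF n(1) card_hyperplane_ge [OF p0 d(1)]]])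
  have "(cmod (extension p ?S f x))\<^sup>2 = (p / card ?S)\<^sup>2" if "x \<in> E" for x
  proof -
    have "(\<Sum>y\<in>?S. f y * chi p (dot y x)) = (\<Sum>y\<in>L. chi p (dot y x))"
      using L_sub finS by (intro sum.mono_neutral_cong_right) (auto simp: f_def)
    also have "\<dots> = (\<Sum>t\<in>Fp p. chi p (dot (pt t) x))"
      unfolding L_def using inj by (simp add: sum.reindex)
    also have "\<dots> = (\<Sum>t\<in>Fp p. chi p (dot v x))"
    proof (intro sum.cong refl)
      fix t
      have "dot (v + t *s d) x = dot v x + t * dot d x"
        by (simp add: dot_def sum.distrib sum_distrib_left algebra_simps)
      moreover have "[dot v x + t * dot d x = dot v x] (mod int p)"
        using E(1) that by (auto simp: cong_iff_dvd_diff)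
      ultimately show "chi p (dot (pt t) x) = chi p (dot v x)"
        using p0 by (simp add: pt_def chi_dot_reduce) (rule chi_cong)
    qed
    also have "\<dots> = of_nat p * chi p (dot v x)" by (simp add: Fp_def)
    finally show ?thesis by (simp add: extension_def norm_mult norm_divide)
  qed
  then have "n * (p / card ?S)\<^sup>2 = (\<Sum>x\<in>E. (cmod (extension p ?S f x))\<^sup>2)"
    by (simp add: E(2))
  also have "\<dots> \<le> real p powr (2 * Lambda p ?S \<theta>) * ((\<Sum>\<xi>\<in>?S. (cmod (f \<xi>))\<^sup>2) / card ?S)"
    using E n(2) by (intro extension_boundD [OF extension_bound_Lambda [OF p0 sphere4_subset]]) auto
  also have "(\<Sum>\<xi>\<in>?S. (cmod (f \<xi>))\<^sup>2) = (\<Sum>\<xi>\<in>L. 1)"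
    using L_sub finS by (intro sum.mono_neutral_cong_right) (auto simp: f_def)
  also have "\<dots> = p" by (simp add: card_L)
  finally have "(real n * p / card ?S) * (p / card ?S) \<le> real p powr (2 * Lambda p ?S \<theta>) * (p / card ?S)"
    by (simp add: power2_eq_square)
  then show ?thesis
    by (rule mult_right_le_imp_le) (use p0 \<open>card ?S > 0\<close> in simp)
qed

section \<open>Exponents of spheres\<close>

text \<open>Plancherel loses the factor \<open>p\<^sup>4 / |S|\<close>. The line test with \<open>p\<^sup>2\<close> points gives
\<open>p\<^sup>3 / |S| \<le> p\<^sup>2\<^sup>\<lambda>\<close> with \<open>\<lambda> = Lambda p (sphere4 p j) 2\<close>, so that factor is at most
\<open>p\<^sup>1\<^sup>+\<^sup>2\<^sup>\<lambda>\<close>. This bounds the size of the sphere from below without counting its points.\<close>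

lemma Lambda_sphere4_le_half:
  assumes p: "prime p" "odd p"
  shows "Lambda p (sphere4 p j) \<theta> \<le> Lambda p (sphere4 p j) 2 + 1 / 2"
proof (rule Lambda_le)
  let ?S = "sphere4 p j"
  have p1: "p > 1" using p(1) prime_gt_1_nat by blast
  have "0 \<le> Lambda p ?S 2" using p1 by (intro Lambda_nonneg sphere4_subset) simp
  then show "0 \<le> Lambda p ?S 2 + 1 / 2" by simp
  have "p\<^sup>2 * p / card ?S \<le> real p powr (2 * Lambda p ?S 2)"
    using p1 line_test [OF p, of "p\<^sup>2" 2 j] by (simp add: powr_numeral power_increasing)
  then have "p * (p\<^sup>2 * p / card ?S) \<le> p * (real p powr (2 * Lambda p ?S 2))"
    by (rule mult_left_mono) simp
  also have "\<dots> = real p powr (2 * (Lambda p ?S 2 + 1 / 2))"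
    using p1 by (simp add: powr_add)
  also have "p * (p\<^sup>2 * p / card ?S) = real p ^ 4 / card ?S"
    by (simp add: power2_eq_square power4_eq_xxxx)
  finally have "real p ^ 4 / card ?S \<le> real p powr (2 * (Lambda p ?S 2 + 1 / 2))" .
  then show "extension_bound p ?S \<theta> (Lambda p ?S 2 + 1 / 2)"
    by (rule extension_bound_plancherel [OF _ sphere4_subset, rotated]) (use p1 in simp)
qed

text \<open>The line test with \<open>\<lfloor>p\<^sup>\<theta>\<rfloor>\<close> points, together with \<open>|S| \<le> 2 p\<^sup>3\<close>. Rounding down and the constant \<open>2\<close>
cost a factor \<open>4\<close> in the squared norm, that is \<open>log p 2\<close> in the exponent.\<close>

lemma Lambda_sphere4_ge:
  assumes p: "prime p" "odd p" and \<theta>: "2 \<le> \<theta>" "\<theta> \<le> 3"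
  shows "(\<theta> - 2) / 2 - log p 2 \<le> Lambda p (sphere4 p j) \<theta>"
proof -
  let ?S = "sphere4 p j"
  have p1: "p > 1" using p(1) prime_gt_1_nat by blast
  define n where "n = nat \<lfloor>real p powr \<theta>\<rfloor>"
  have "1 \<le> real p powr \<theta>" using p1 \<theta> by (simp add: ge_one_powr_ge_zero)
  then have n: "real n \<le> real p powr \<theta>" "real p powr \<theta> \<le> 2 * real n"
  proof -
    have "real n = real_of_int \<lfloor>real p powr \<theta>\<rfloor>" "1 \<le> \<lfloor>real p powr \<theta>\<rfloor>"
      using \<open>1 \<le> real p powr \<theta>\<close> by (simp_all add: n_def le_floor_iff)
    then show "real n \<le> real p powr \<theta>" "real p powr \<theta> \<le> 2 * real n"
      by linarith+
  qed
  have "real p powr \<theta> \<le> real p powr 3" using p1 \<theta> by (intro powr_mono) auto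
  also have "\<dots> = real (p ^ 3)" using p1 by (simp add: powr_numeral)
  finally have "n \<le> p ^ 3" using n(1) by linarith
  then have test: "real n * p / card ?S \<le> real p powr (2 * Lambda p ?S \<theta>)"
    using n(1) by (intro line_test p)
  have "card ?S > 0" by (rule card_sphere4_pos [OF p])
  have "real p powr (\<theta> - 2 - 2 * log p 2) = real p powr \<theta> / 2 * p / (2 * p ^ 3)"
  proof -
    have four: "real p powr (2 * log p 2) = 4"
      unfolding mult_2 powr_add using p1 by simp
    have "real p powr (\<theta> - 2 - 2 * log p 2) = real p powr \<theta> / real p ^ 2 / 4"
      unfolding powr_diff four using p1 by (simp add: powr_numeral)
    also have "\<dots> = real p powr \<theta> / 2 * p / (2 * p ^ 3)"
      using p1 by (simp add: power2_eq_square power3_eq_cube)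
    finally show ?thesis .
  qed
  also have "\<dots> \<le> real n * p / card ?S"
  proof (rule frac_le)
    show "real (card ?S) \<le> 2 * p ^ 3"
      using card_sphere4_le [OF p(1), of j] by (metis of_nat_le_iff of_nat_mult of_nat_numeral of_nat_power)
    show "real p powr \<theta> / 2 * p \<le> real n * p" 
      using mult_right_mono [OF n(2), of "real p"] by (simp add: algebra_simps)
  qed (use \<open>card ?S > 0\<close> in simp_all)
  also note test
  finally have "\<theta> - 2 - 2 * log p 2 \<le> 2 * Lambda p ?S \<theta>"
    using p1 by simp
  then show ?thesis by (simp add: field_simps)
qed

text \<open>The error does not depend on \<open>\<theta>\<close>, and it depends on \<open>j\<close> only through the value at \<open>2\<close>; this is
the source of the uniformity in the theorem. Monotonicity carries the upper bound at \<open>2\<close> to all smaller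
\<open>\<theta>\<close> and the lower bound at \<open>3\<close> to all larger ones.\<close>

lemma Lambda_sphere4_near_flat:
  assumes p: "prime p" "odd p"
  shows "\<bar>Lambda p (sphere4 p j) \<theta> - Lambda_flat \<theta>\<bar> \<le> Lambda p (sphere4 p j) 2 + log p 2"
proof -
  let ?\<Lambda> = "Lambda p (sphere4 p j)"
  have p1: "p > 1" using p(1) prime_gt_1_nat by blast
  have nonneg: "0 \<le> ?\<Lambda> \<theta>" for \<theta> using p1 by (intro Lambda_nonneg sphere4_subset) simp
  have mono: "?\<Lambda> s \<le> ?\<Lambda> t" if "s \<le> t" for s t
    using p1 that by (intro Lambda_mono sphere4_subset) simp_all
  have log: "0 < log p 2" using p1 by simp
  consider "\<theta> < 2" | "2 \<le> \<theta>" "\<theta> \<le> 3" | "3 < \<theta>" by linarith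
  then show ?thesis
  proof cases
    case 1
    then have "Lambda_flat \<theta> = 0" by (simp add: Lambda_flat_def)
    then show ?thesis using nonneg [of \<theta>] mono [of \<theta> 2] 1 log by linarith
  next
    case 2
    then have "Lambda_flat \<theta> = (\<theta> - 2) / 2" by (simp add: Lambda_flat_def)
    then show ?thesis
      using Lambda_le_split [OF p1 sphere4_subset 2(1), of j] Lambda_sphere4_ge [OF p 2, of j]
        nonneg [of 2] log by linarith
  next
    case 3
    then have "Lambda_flat \<theta> = 1 / 2" by (simp add: Lambda_flat_def)
    moreover have "1 / 2 - log p 2 \<le> ?\<Lambda> 3" using Lambda_sphere4_ge [OF p, of 3 j] by simp
    ultimately show ?thesis
      using Lambda_sphere4_le_half [OF p, of j \<theta>] mono [of 3 \<theta>] 3 nonneg [of 2] log by linarith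
  qed
qed

section \<open>Uniformity over the spheres\<close>

lemma abs_SUP_diff_le:
  fixes a b :: "'a \<Rightarrow> real"
  assumes "finite J" "J \<noteq> {}" and ab: "\<And>j. j \<in> J \<Longrightarrow> \<bar>a j - c\<bar> \<le> b j + e"
  shows "\<bar>(SUP j\<in>J. a j) - c\<bar> \<le> (SUP j\<in>J. b j) + e"
proof -
  have up: "b j \<le> (SUP j\<in>J. b j)" "a j \<le> (SUP j\<in>J. a j)" if "j \<in> J" for j
    using assms(1) that by (intro cSUP_upper; simp)+
  have "(SUP j\<in>J. a j) \<le> c + (SUP j\<in>J. b j) + e"
  proof (rule cSUP_least)
    fix j assume "j \<in> J"
    then show "a j \<le> c + (SUP j\<in>J. b j) + e" using ab [of j] up [of j] by linarith
  qed (rule assms(2))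
  moreover obtain j where "j \<in> J" using assms(2) by blast
  ultimately show ?thesis using ab [of j] up [of j] by linarith
qed

theorem proposition8p4:
  shows "uniform_limit {0..4}
           (\<lambda>p \<theta>. SUP j\<in>Fp_units p. Lambda p (sphere4 p j) \<theta>) Lambda_flat odd_primes_at_top
         \<longleftrightarrow>
         ((\<lambda>p. SUP j\<in>Fp_units p. Lambda p (sphere4 p j) 2) \<longlongrightarrow> 0) odd_primes_at_top"
    (is "?uniform \<longleftrightarrow> ?endpoint")
proof
  assume ?uniform
  from tendsto_uniform_limitI [OF this, of 2] show ?endpoint
    by (simp add: Lambda_flat_def)
next
  assume endpoint: ?endpoint
  let ?\<epsilon> = "\<lambda>p::nat. (SUP j\<in>Fp_units p. Lambda p (sphere4 p j) 2) + log p 2"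
  have "((\<lambda>p::nat. log p 2) \<longlongrightarrow> 0) at_top"
    unfolding log_def
    by (intro tendsto_divide_0 [OF tendsto_const] filterlim_at_top_imp_at_infinity
        filterlim_compose [OF ln_at_top] filterlim_real_sequentially)
  then have "((\<lambda>p::nat. log p 2) \<longlongrightarrow> 0) odd_primes_at_top"
    unfolding odd_primes_at_top_def by (rule tendsto_mono [OF inf_le1])
  from tendsto_add [OF endpoint this] have lim: "(?\<epsilon> \<longlongrightarrow> 0) odd_primes_at_top"
    by simp
  show ?uniform
  proof (rule uniform_limitI)
    fix e :: real assume "e > 0"
    from lim this have "\<forall>\<^sub>F p in odd_primes_at_top. ?\<epsilon> p < e" by (rule order_tendstoD)
    moreover have "\<forall>\<^sub>F p in odd_primes_at_top. prime p \<and> odd p"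
      by (simp add: odd_primes_at_top_def eventually_inf_principal)
    ultimately show "\<forall>\<^sub>F p in odd_primes_at_top. \<forall>\<theta>\<in>{0..4}.
        dist (SUP j\<in>Fp_units p. Lambda p (sphere4 p j) \<theta>) (Lambda_flat \<theta>) < e"
    proof eventually_elim
      case (elim p)
      have "1 \<in> Fp_units p" "finite (Fp_units p)"
        using elim prime_gt_1_nat by (auto simp: Fp_units_def Fp_def)
      then have "\<bar>(SUP j\<in>Fp_units p. Lambda p (sphere4 p j) \<theta>) - Lambda_flat \<theta>\<bar> \<le> ?\<epsilon> p" for \<theta>
        using elim by (intro abs_SUP_diff_le Lambda_sphere4_near_flat) auto
      then show ?case using elim(1) by (auto simp: dist_real_def intro: le_less_trans)
    qed
  qed
qed

end
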